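(* Let $\mathbb{D}$ be the open unit disc in $\mathbb{C}$ and let $\rho$ be the hyperbolic distance on $\mathbb{D}$. Suppose that $g$ is either the identity function on $\mathbb{D}$ or an elliptic Möbius transformation that fixes $\mathbb{D}$, and that $g_1,g_2,\dotsc$ are non-constant holomorphic self-maps of $\mathbb{D}$ for which \[ \sum_{n=1}^\infty \rho(g_n(a),g(a))<+\infty\quad\text{and}\quad\sum_{n=1}^\infty \rho(g_n(b),g(b))<+\infty, \] for two distinct points $a,b\in\mathbb{D}$. Then the sequence $(G_n\circ g^{-n})_{n\geq 1}$, where $G_n=g_1\circ g_2\circ\dotsb\circ g_n$, converges locally uniformly on $\mathbb{D}$ to a non-constant holomorphic self-map of $\mathbb{D}$.
   Context: $\mathbb{D}=\{z\in\mathbb{C}:|z|<1\}$. A holomorphic self-map of $\mathbb{D}$ is a holomorphic function $\mathbb{D}\to\mathbb{D}$. The hyperbolic distance $\rho$ on $\mathbb{D}$ is the distance function of the Riemannian metric $2|dz|/(1-|z|^2)$; equivalently $\sinh\tfrac12\rho(z,w)=|z-w|/\sqrt{(1-|z|^2)(1-|w|^2)}$. An elliptic Möbius transformation that fixes $\mathbb{D}$ is a conformal automorphism of $\mathbb{D}$ that is conjugate, by another conformal automorphism of $\mathbb{D}$, to a rotation about the origin. For a conformal automorphism $g$ of $\mathbb{D}$, $g^n$ is the $n$-fold composition of $g$ with itself and $g^{-n}$ is the inverse function of $g^n$. Locally uniform convergence on $\mathbb{D}$ means uniform convergence on compact subsets of $\mathbb{D}$ with respect to the Euclidean metric. *)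

theory Defs
  imports "HOL-Complex_Analysis.Complex_Analysis"
begin

abbreviation unit_disc :: "complex set" ("\<D>")
  where "\<D> \<equiv> ball 0 1"

(* hyp_dist uses curves that are C1 on all of [0,1], corners excluded: a general valid_path need not
   be rectifiable, and integral is 0, not infinity, on a non-integrable speed. The infimum is the
   usual Riemannian distance, as confirmed by sinh_hyp_dist below. *)
definition hyp_length :: "(real \<Rightarrow> complex) \<Rightarrow> real"
  where "hyp_length \<gamma> =
    integral {0..1} (\<lambda>t. 2 * norm (vector_derivative \<gamma> (at t)) / (1 - (norm (\<gamma> t))\<^sup>2))"

definition hyp_dist :: "complex \<Rightarrow> complex \<Rightarrow> real"
  where "hyp_dist z w = Inf {hyp_length \<gamma> | \<gamma>. \<gamma> C1_differentiable_on {0..1} \<and>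
    path_image \<gamma> \<subseteq> \<D> \<and> pathstart \<gamma> = z \<and> pathfinish \<gamma> = w}"

lemma pick_norm:
  assumes "norm (z::complex) < 1" "norm w < 1"
  shows "1 - cnj z * w \<noteq> 0"
    and "1 - (norm ((w - z) / (1 - cnj z * w)))\<^sup>2
      = (1 - (norm z)\<^sup>2) * (1 - (norm w)\<^sup>2) / (norm (1 - cnj z * w))\<^sup>2"
proof -
  have "norm (cnj z * w) < 1" using norm_mult_less[of "cnj z" 1 w 1] assms by simp
  then show nz: "1 - cnj z * w \<noteq> 0" by auto
  have "(norm (1 - cnj z * w))\<^sup>2 - (norm (w - z))\<^sup>2 = (1 - (norm z)\<^sup>2) * (1 - (norm w)\<^sup>2)"
    unfolding cmod_power2 by (simp add: power2_eq_square algebra_simps)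
  then show "1 - (norm ((w - z) / (1 - cnj z * w)))\<^sup>2
      = (1 - (norm z)\<^sup>2) * (1 - (norm w)\<^sup>2) / (norm (1 - cnj z * w))\<^sup>2"
    using nz by (simp add: norm_divide power_divide field_simps)
qed

lemma norm_sq_lt: "norm (z::complex) < 1 \<Longrightarrow> (norm z)\<^sup>2 < 1"
  by (simp add: abs_square_less_1)

lemma pick_less:
  assumes "norm (z::complex) < 1" "norm w < 1"
  shows "norm ((w - z) / (1 - cnj z * w)) < 1"
proof -
  have "0 < 1 - (norm ((w - z) / (1 - cnj z * w)))\<^sup>2"
    unfolding pick_norm(2)[OF assms] using assms pick_norm(1)[OF assms] norm_sq_lt[of z] norm_sq_lt[of w]
    by (intro divide_pos_pos mult_pos_pos) auto
  then show ?thesis using abs_square_less_1[of "norm ((w - z) / (1 - cnj z * w))"] by simp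
qed

lemma pick_deriv:
  assumes "norm z < 1" "norm w < 1"
  shows "((\<lambda>x. (x - z) / (1 - cnj z * x)) has_field_derivative
    of_real (1 - (norm z)\<^sup>2) / (1 - cnj z * w)\<^sup>2) (at w)"
proof -
  have "((\<lambda>x. (x - z) / (1 - cnj z * x)) has_field_derivative
     (1 * (1 - cnj z * w) - (w - z) * (- cnj z)) / ((1 - cnj z * w) * (1 - cnj z * w))) (at w)"
    using pick_norm(1)[OF assms] by (intro DERIV_divide) (auto intro!: derivative_eq_intros)
  moreover have "1 * (1 - cnj z * w) - (w - z) * (- cnj z) = of_real (1 - (norm z)\<^sup>2)"
    unfolding of_real_diff complex_norm_square by (simp add: algebra_simps)
  ultimately show ?thesis by (simp only: power2_eq_square)
qed

lemma hyp_integrable: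
  assumes C: "\<gamma> C1_differentiable_on {0..1}" and D: "path_image \<gamma> \<subseteq> \<D>"
  shows "(\<lambda>t. 2 * norm (vector_derivative \<gamma> (at t)) / (1 - (norm (\<gamma> t))\<^sup>2)) integrable_on {0..1}"
proof (rule integrable_continuous_real)
  have "continuous_on {0..1} \<gamma>" using C by (rule C1_differentiable_imp_continuous_on)
  moreover have "continuous_on {0..1} (\<lambda>t. vector_derivative \<gamma> (at t))"
    using C by (simp add: C1_differentiable_on_eq)
  moreover have "1 - (norm (\<gamma> t))\<^sup>2 \<noteq> 0" if "t \<in> {0..1}" for t
    using D that norm_sq_lt[of "\<gamma> t"] by (force simp: path_image_def)
  ultimately show "continuous_on {0..1} (\<lambda>t. 2 * norm (vector_derivative \<gamma> (at t)) / (1 - (norm (\<gamma> t))\<^sup>2))"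
    by (intro continuous_intros) auto
qed

lemma obtain_unit:
  obtains u :: complex where "norm u = 1" "v = of_real (norm v) * u"
proof (cases "v = 0")
  case True then show ?thesis using that[of 1] by simp
next
  case False then show ?thesis using that[of "sgn v"] by (simp add: norm_sgn) (simp add: sgn_div_norm scaleR_conv_of_real)
qed

lemma hyp_length_ge:
  assumes C: "\<gamma> C1_differentiable_on {0..1}" and D: "path_image \<gamma> \<subseteq> \<D>"
    and z: "pathstart \<gamma> = z" and w: "pathfinish \<gamma> = w"
    and r: "r = norm ((w - z) / (1 - cnj z * w))"
  shows "hyp_length \<gamma> \<ge> ln ((1 + r) / (1 - r))"
proof -
  have z1: "norm z < 1" and w1: "norm w < 1"
    using D z w by auto
  obtain u where u: "norm u = 1" and ru: "(w - z) / (1 - cnj z * w) = of_real r * u"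
    using obtain_unit r by metis
  have uu: "cnj u * u = 1" using u by (metis complex_norm_square mult.commute of_real_1 power_one)
  define M where "M = (\<lambda>x. cnj u * ((x - z) / (1 - cnj z * x)))"
  define M' where "M' = (\<lambda>x. cnj u * (of_real (1 - (norm z)\<^sup>2) / (1 - cnj z * x)\<^sup>2))"
  define L where "L = (\<lambda>x. Ln (1 + M x) - Ln (1 - M x))"
  define L' where "L' = (\<lambda>x. M' x / (1 + M x) + M' x / (1 - M x))"
  have Mlt: "norm (M x) < 1" if "norm x < 1" for x
    using pick_less[OF z1 that] u by (simp add: M_def norm_mult norm_divide)
  have dM: "(M has_field_derivative M' x) (at x)" if "norm x < 1" for x
    unfolding M_def M'_def
    by (intro DERIV_cmult pick_deriv z1 that)
  have Re: "Re (1 + M x) > 0" "Re (1 - M x) > 0" if "norm x < 1" for x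
    using Mlt[OF that] abs_Re_le_cmod[of "M x"] by auto
  have dL: "(L has_field_derivative L' x) (at x)" if "norm x < 1" for x
  proof -
    have "1 + M x \<notin> \<real>\<^sub>\<le>\<^sub>0" "1 - M x \<notin> \<real>\<^sub>\<le>\<^sub>0"
      using Re[OF that] by (auto simp: complex_nonpos_Reals_iff)
    note Ln = this[THEN has_field_derivative_Ln]
    have "((\<lambda>x. Ln (1 + M x)) has_field_derivative M' x / (1 + M x)) (at x)"
      using DERIV_chain2[OF Ln(1) DERIV_add[OF DERIV_const dM[OF that]]] by (simp add: field_simps)
    moreover have "((\<lambda>x. Ln (1 - M x)) has_field_derivative - (M' x / (1 - M x))) (at x)"
      using DERIV_chain2[OF Ln(2) DERIV_diff[OF DERIV_const dM[OF that]]] by (simp add: field_simps)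
    ultimately show ?thesis
      unfolding L_def L'_def by (auto dest: DERIV_diff)
  qed
  have nM': "norm (M' x) / (1 - (norm (M x))\<^sup>2) = 1 / (1 - (norm x)\<^sup>2)" if "norm x < 1" for x
  proof -
    have e: "1 - (norm (M x))\<^sup>2 = (1 - (norm z)\<^sup>2) * (1 - (norm x)\<^sup>2) / (norm (1 - cnj z * x))\<^sup>2"
      using pick_norm(2)[OF z1 that] u by (simp add: M_def norm_mult norm_divide)
    have "norm (M' x) = (1 - (norm z)\<^sup>2) / (norm (1 - cnj z * x))\<^sup>2"
      using norm_sq_lt[OF z1] u by (simp add: M'_def norm_mult norm_divide norm_power del: of_real_diff)
    with e show ?thesis
      using pick_norm(1)[OF z1 that] norm_sq_lt[OF z1] norm_sq_lt[OF that] by simp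
  qed
  have nL': "norm (L' x) \<le> 2 / (1 - (norm x)\<^sup>2)" if "norm x < 1" for x
  proof -
    have nz: "1 + M x \<noteq> 0" "1 - M x \<noteq> 0" using Re[OF that] by (metis less_irrefl zero_complex.sel(1))+
    have "L' x = 2 * M' x / (1 - (M x)\<^sup>2)"
    proof -
      have "1 - (M x)\<^sup>2 = (1 + M x) * (1 - M x)" by (simp add: power2_eq_square algebra_simps)
      then show ?thesis using nz by (simp add: L'_def add_frac_eq algebra_simps)
    qed
    then have "norm (L' x) = 2 * norm (M' x) / norm (1 - (M x)\<^sup>2)"
      by (simp add: norm_divide norm_mult)
    also have "\<dots> \<le> 2 * norm (M' x) / (1 - (norm (M x))\<^sup>2)"
    proof (rule divide_left_mono)
      show "1 - (norm (M x))\<^sup>2 \<le> norm (1 - (M x)\<^sup>2)"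
        using norm_triangle_ineq2[of 1 "(M x)\<^sup>2"] by (simp add: norm_power)
      have "1 - (norm (M x))\<^sup>2 > 0" using norm_sq_lt[OF Mlt[OF that]] by simp
      then show "0 < norm (1 - (M x)\<^sup>2) * (1 - (norm (M x))\<^sup>2)"
        using \<open>1 - (norm (M x))\<^sup>2 \<le> norm (1 - (M x)\<^sup>2)\<close> by (intro mult_pos_pos) auto
    qed simp
    also have "\<dots> = 2 / (1 - (norm x)\<^sup>2)" using nM'[OF that] by simp
    finally show ?thesis .
  qed
  have Din: "norm (\<gamma> t) < 1" if "t \<in> {0..1}" for t
    using D that by (force simp: path_image_def)
  have I: "((\<lambda>t. L' (\<gamma> t) * vector_derivative \<gamma> (at t)) has_integral (L w - L z)) {0..1}"
  proof -
    have "(L' has_contour_integral (L (pathfinish \<gamma>) - L (pathstart \<gamma>))) \<gamma>"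
    proof (rule contour_integral_primitive)
      show "(L has_field_derivative L' x) (at x within \<D>)" if "x \<in> \<D>" for x
        using dL[of x] that by (auto intro: has_field_derivative_at_within)
      show "valid_path \<gamma>"
        using C by (simp add: valid_path_def C1_differentiable_imp_piecewise)
    qed (fact D)
    then show ?thesis by (simp add: has_contour_integral z w)
  qed
  have "norm (integral {0..1} (\<lambda>t. L' (\<gamma> t) * vector_derivative \<gamma> (at t))) \<le> hyp_length \<gamma>"
    unfolding hyp_length_def
  proof (rule integral_norm_bound_integral)
    show "norm (L' (\<gamma> t) * vector_derivative \<gamma> (at t)) \<le> 2 * norm (vector_derivative \<gamma> (at t)) / (1 - (norm (\<gamma> t))\<^sup>2)"
      if "t \<in> {0..1}" for t
      using mult_right_mono[OF nL'[OF Din[OF that]], of "norm (vector_derivative \<gamma> (at t))"]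
      by (simp add: norm_mult)
  qed (use I hyp_integrable[OF C D] in auto)
  then have le: "norm (L w - L z) \<le> hyp_length \<gamma>"
    using I by (simp add: integral_unique)
  have Mz: "M z = 0" by (simp add: M_def)
  have Mw: "M w = of_real r" unfolding M_def ru using uu by (simp add: mult.left_commute)
  have r1: "0 \<le> r" "r < 1" using pick_less[OF z1 w1] r by auto
  have "L w - L z = of_real (ln (1 + r) - ln (1 - r))"
    using r1 Ln_of_real[of "1 + r"] Ln_of_real[of "1 - r"] by (simp add: L_def Mz Mw)
  then have "ln (1 + r) - ln (1 - r) \<le> hyp_length \<gamma>"
    using le by (simp only: norm_of_real)
  then show ?thesis using r1 by (simp add: ln_div)
qed

lemma hyp_length_attained:
  assumes z1: "norm z < 1" and w1: "norm w < 1"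
    and r: "r = norm ((w - z) / (1 - cnj z * w))"
  obtains \<gamma> where "\<gamma> C1_differentiable_on {0..1}" "path_image \<gamma> \<subseteq> \<D>"
    "pathstart \<gamma> = z" "pathfinish \<gamma> = w" "hyp_length \<gamma> = ln ((1 + r) / (1 - r))"
proof -
  obtain u where u: "norm u = 1" and ru: "(w - z) / (1 - cnj z * w) = of_real r * u"
    using obtain_unit r by metis
  have r1: "0 \<le> r" "r < 1" using pick_less[OF z1 w1] r by auto
  define v where "v = of_real r * u"
  have nv: "norm v = r" using u r1 by (simp add: v_def norm_mult)
  have v1: "norm (of_real t * v) < 1" if "t \<in> {0..1}" for t
    using that r1 mult_left_le_one_le[of r t] by (simp add: norm_mult nv)
  define \<gamma> where "\<gamma> = (\<lambda>t::real. (of_real t * v - (- z)) / (1 - cnj (- z) * (of_real t * v)))"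
  define \<gamma>' where "\<gamma>' = (\<lambda>t::real. v * of_real (1 - (norm z)\<^sup>2) / (1 - cnj (- z) * (of_real t * v))\<^sup>2)"
  have z': "norm (- z) < 1" using z1 by simp
  note nz = pick_norm(1)[OF z' v1] and pn = pick_norm(2)[OF z' v1]
  have d: "(\<gamma> has_vector_derivative \<gamma>' t) (at t)" if "t \<in> {0..1}" for t
  proof -
    have "((\<lambda>x. x * v) has_field_derivative v) (at (of_real t))"
      by (auto intro!: derivative_eq_intros)
    from DERIV_chain2[OF pick_deriv[OF z' v1[OF that]] this]
    have "((\<lambda>x. (x * v - (- z)) / (1 - cnj (- z) * (x * v))) has_field_derivative \<gamma>' t) (at (of_real t))"
      by (simp add: \<gamma>'_def mult.commute)
    from has_vector_derivative_real_field[OF this] show ?thesis by (simp add: \<gamma>_def)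
  qed
  have C: "\<gamma> C1_differentiable_on {0..1}"
    unfolding C1_differentiable_on_def
  proof (intro exI[of _ \<gamma>'] conjI ballI d)
    show "continuous_on {0..1} \<gamma>'"
      unfolding \<gamma>'_def using nz by (intro continuous_intros) auto
  qed
  have D: "path_image \<gamma> \<subseteq> \<D>"
    unfolding path_image_def \<gamma>_def using pick_less[OF z' v1] by auto
  have s: "pathstart \<gamma> = z" by (simp add: pathstart_def \<gamma>_def)
  have f: "pathfinish \<gamma> = w"
  proof -
    have "v = (w - z) / (1 - cnj z * w)" using ru v_def by simp
    then have v: "v * (1 - cnj z * w) = w - z" using pick_norm(1)[OF z1 w1] by simp
    then have "v + z = w * (1 + cnj z * v)" by (simp add: algebra_simps)
    moreover have "1 + cnj z * v \<noteq> 0" using nz[of 1] by simp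
    ultimately show ?thesis by (simp add: pathfinish_def \<gamma>_def)
  qed
  have "((\<lambda>t. 2 * r / (1 - (t * r)\<^sup>2)) has_integral (ln (1 + 1 * r) - ln (1 - 1 * r)) - (ln (1 + 0 * r) - ln (1 - 0 * r))) {0..1}"
  proof (rule fundamental_theorem_of_calculus)
    fix t :: real assume t: "t \<in> {0..1}"
    have tr: "0 \<le> t * r" "t * r < 1" using t r1 mult_left_le_one_le[of r t] by auto
    then have "((\<lambda>t. ln (1 + t * r) - ln (1 - t * r)) has_field_derivative r / (1 + t * r) + r / (1 - t * r)) (at t)"
      by (auto intro!: derivative_eq_intros)
    moreover have "r / (1 + t * r) + r / (1 - t * r) = 2 * r / (1 - (t * r)\<^sup>2)"
    proof -
      have "1 - (t * r)\<^sup>2 = (1 + t * r) * (1 - t * r)" by (simp add: power2_eq_square algebra_simps)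
      then show ?thesis using tr by (simp add: add_frac_eq add_nonneg_eq_0_iff algebra_simps)
    qed
    ultimately show "((\<lambda>t. ln (1 + t * r) - ln (1 - t * r)) has_vector_derivative 2 * r / (1 - (t * r)\<^sup>2)) (at t within {0..1})"
      by (simp add: has_real_derivative_iff_has_vector_derivative has_vector_derivative_at_within)
  qed simp
  then have "integral {0..1} (\<lambda>t. 2 * r / (1 - (t * r)\<^sup>2)) = ln ((1 + r) / (1 - r))"
    using r1 by (simp add: integral_unique ln_div)
  moreover have "hyp_length \<gamma> = integral {0..1} (\<lambda>t. 2 * r / (1 - (t * r)\<^sup>2))"
    unfolding hyp_length_def
  proof (rule integral_cong)
    fix t :: real assume t: "t \<in> {0..1}"
    have "vector_derivative \<gamma> (at t) = \<gamma>' t" using d[OF t] by (rule vector_derivative_at)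
    moreover have "norm (\<gamma>' t) = r * (1 - (norm z)\<^sup>2) / (norm (1 - cnj (- z) * (of_real t * v)))\<^sup>2"
      using norm_sq_lt[OF z1] by (simp add: \<gamma>'_def norm_mult norm_divide norm_power nv del: of_real_diff)
    moreover have "1 - (norm (\<gamma> t))\<^sup>2 = (1 - (norm z)\<^sup>2) * (1 - (t * r)\<^sup>2) / (norm (1 - cnj (- z) * (of_real t * v)))\<^sup>2"
      using pn[OF t] t r1 by (simp add: \<gamma>_def norm_mult nv)
    ultimately show "2 * norm (vector_derivative \<gamma> (at t)) / (1 - (norm (\<gamma> t))\<^sup>2) = 2 * r / (1 - (t * r)\<^sup>2)"
      using nz[OF t] norm_sq_lt[OF z1] by simp
  qed
  ultimately show ?thesis using that C D s f by simp
qed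

lemma hyp_dist_eq_ln:
  assumes z1: "norm z < 1" and w1: "norm w < 1"
    and r: "r = norm ((w - z) / (1 - cnj z * w))"
  shows "hyp_dist z w = ln ((1 + r) / (1 - r))"
  unfolding hyp_dist_def
proof (rule cInf_eq_minimum)
  show "ln ((1 + r) / (1 - r)) \<in> {hyp_length \<gamma> | \<gamma>. \<gamma> C1_differentiable_on {0..1} \<and>
    path_image \<gamma> \<subseteq> \<D> \<and> pathstart \<gamma> = z \<and> pathfinish \<gamma> = w}"
    using hyp_length_attained[OF assms] by (smt (verit) mem_Collect_eq)
qed (use hyp_length_ge r in auto)

lemma sinh_hyp_dist:
  assumes "z \<in> \<D>" and "w \<in> \<D>"
  shows "sinh (hyp_dist z w / 2)
    = norm (z - w) / sqrt ((1 - (norm z)\<^sup>2) * (1 - (norm w)\<^sup>2))"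
proof -
  have z1: "norm z < 1" and w1: "norm w < 1" using assms by auto
  define r where r: "r = norm ((w - z) / (1 - cnj z * w))"
  have r1: "0 \<le> r" "r < 1" using pick_less[OF z1 w1] r by auto
  define x where "x = sqrt ((1 + r) / (1 - r))"
  have x: "x > 0" "x\<^sup>2 = (1 + r) / (1 - r)" using r1 by (auto simp: x_def)
  have "hyp_dist z w / 2 = ln x"
    unfolding hyp_dist_eq_ln[OF z1 w1 r] x_def using r1 by (simp add: ln_sqrt)
  then have "sinh (hyp_dist z w / 2) = (x - inverse x) / 2"
    using x by (simp add: sinh_ln_real)
  also have "\<dots> = r / sqrt (1 - r\<^sup>2)"
  proof -
    have e: "sqrt (1 - r\<^sup>2) = (1 - r) * x"
    proof (rule real_sqrt_unique)
      show "((1 - r) * x)\<^sup>2 = 1 - r\<^sup>2"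
      proof -
        have "(1 - r) * x\<^sup>2 = 1 + r" using r1 by (simp add: x(2))
        then have "(1 - r) * ((1 - r) * x\<^sup>2) = (1 - r) * (1 + r)" by simp
        then show ?thesis by (simp add: power2_eq_square algebra_simps)
      qed
    qed (use r1 x in auto)
    have "(x - inverse x) / 2 = (x\<^sup>2 - 1) / (2 * x)" using x by (simp add: field_simps power2_eq_square)
    also have "\<dots> = r / ((1 - r) * x)" using x r1 by (simp add: x(2)) (simp add: field_simps)
    finally show ?thesis using e by simp
  qed
  also have "1 - r\<^sup>2 = (1 - (norm z)\<^sup>2) * (1 - (norm w)\<^sup>2) / (norm (1 - cnj z * w))\<^sup>2"
    unfolding r by (rule pick_norm(2)[OF z1 w1])
  also have "r / sqrt ((1 - (norm z)\<^sup>2) * (1 - (norm w)\<^sup>2) / (norm (1 - cnj z * w))\<^sup>2)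
     = norm (z - w) / sqrt ((1 - (norm z)\<^sup>2) * (1 - (norm w)\<^sup>2))"
    using pick_norm(1)[OF z1 w1] by (simp add: r real_sqrt_divide norm_divide norm_minus_commute)
  finally show ?thesis .
qed

definition disc_selfmap :: "(complex \<Rightarrow> complex) \<Rightarrow> bool"
  where "disc_selfmap f \<longleftrightarrow> f holomorphic_on \<D> \<and> f \<in> \<D> \<rightarrow> \<D>"

definition disc_automorphism :: "(complex \<Rightarrow> complex) \<Rightarrow> bool"
  where "disc_automorphism f \<longleftrightarrow> f holomorphic_on \<D> \<and> bij_betw f \<D> \<D>"

(* As the angle 0 is allowed, this includes the identity of the disc. *)
definition disc_elliptic :: "(complex \<Rightarrow> complex) \<Rightarrow> bool"
  where "disc_elliptic g \<longleftrightarrow> disc_automorphism g \<and>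
    (\<exists>\<phi> c. disc_automorphism \<phi> \<and> norm c = 1 \<and> (\<forall>z\<in>\<D>. g z = inv_into \<D> \<phi> (c * \<phi> z)))"

(* inner_comp f n = f 1 o f 2 o ... o f n; f 0 is never used. *)
fun inner_comp :: "(nat \<Rightarrow> complex \<Rightarrow> complex) \<Rightarrow> nat \<Rightarrow> complex \<Rightarrow> complex"
  where
    "inner_comp f 0 = id"
  | "inner_comp f (Suc n) = inner_comp f n \<circ> f (Suc n)"

(* Inverse taken on the disc only: nothing is assumed about g elsewhere. *)
definition disc_iterate_inv :: "(complex \<Rightarrow> complex) \<Rightarrow> nat \<Rightarrow> complex \<Rightarrow> complex"
  where "disc_iterate_inv g n = inv_into \<D> (g ^^ n)"

end

theory Submission
  imports Defs
begin

text \<open>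
  Write \<open>u\<^sub>n = g\<^sup>-\<^sup>1 \<circ> f\<^sub>n\<close> and \<open>h\<^sub>n = g\<^sup>n \<circ> u\<^sub>n \<circ> g\<^sup>-\<^sup>n\<close>. Then \<open>f\<^sub>1 \<circ> \<dots> \<circ> f\<^sub>n \<circ> g\<^sup>-\<^sup>n\<close> telescopes to the
  inner composition \<open>H\<^sub>n = h\<^sub>1 \<circ> \<dots> \<circ> h\<^sub>n\<close>, so that the motion \<open>g\<close> disappears and the task is to
  compose self-maps of the disc that are close to the identity. By hypothesis \<open>u\<^sub>n\<close> moves the two
  points \<open>a\<close> and \<open>b\<close> by amounts with finite sum.

  A self-map that moves two points by at most \<open>\<epsilon>\<close> moves every point of a compact set by at most
  \<open>C \<epsilon>\<close> (lemma \<open>disc_selfmap_near_identity\<close>). This linear stability form of uniqueness in the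
  Schwarz--Pick lemma is the heart of the proof. An elliptic \<open>g\<close> is conjugate to a rotation,
  so every compact set lies in a compact set \<open>L\<close> with \<open>g ` L = L\<close>
  (lemma \<open>disc_elliptic_invariant_compact\<close>); on \<open>L\<close> the bound for \<open>u\<^sub>n\<close> passes to its conjugate
  \<open>h\<^sub>n\<close> with a constant that does not depend on \<open>n\<close>. Hence the displacements of the \<open>h\<^sub>n\<close> are
  summable, uniformly on compact sets.

  Self-maps of the disc are Lipschitz on compact sets with a common constant
  (lemma \<open>disc_selfmap_lipschitz\<close>). As \<open>H\<^sub>n\<^sub>+\<^sub>1 = H\<^sub>n \<circ> h\<^sub>n\<^sub>+\<^sub>1\<close>, the difference of \<open>H\<^sub>n\<^sub>+\<^sub>1\<close> and \<open>H\<^sub>n\<close> is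
  bounded by a multiple of the displacement of \<open>h\<^sub>n\<^sub>+\<^sub>1\<close>, and the sequence converges by the Weierstrass
  M-test. The limit is not constant: it factors as \<open>H\<^sub>m \<circ> T\<close>, where \<open>T\<close> is the limit of the
  compositions \<open>h\<^sub>m\<^sub>+\<^sub>1 \<circ> \<dots> \<circ> h\<^sub>n\<close>, and for large \<open>m\<close> the total displacement of this tail is so small
  that \<open>T\<close> separates two given points.
\<close>

section \<open>Self-maps and automorphisms of the disc\<close>

lemma disc_selfmap_in: "disc_selfmap f \<Longrightarrow> z \<in> \<D> \<Longrightarrow> f z \<in> \<D>"
  unfolding disc_selfmap_def by blast

lemma disc_selfmap_norm: "disc_selfmap f \<Longrightarrow> norm z < 1 \<Longrightarrow> norm (f z) < 1"
  using disc_selfmap_in[of f z] by simp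

lemma disc_selfmap_holomorphic: "disc_selfmap f \<Longrightarrow> f holomorphic_on \<D>"
  unfolding disc_selfmap_def by blast

lemma disc_selfmap_compact_image:
  assumes f: "disc_selfmap f" and K: "compact K" "K \<subseteq> \<D>"
  shows "compact (f ` K)" "f ` K \<subseteq> \<D>"
proof -
  have "continuous_on K f"
    using holomorphic_on_imp_continuous_on[OF disc_selfmap_holomorphic[OF f]] K(2)
    by (rule continuous_on_subset)
  then show "compact (f ` K)"
    using K(1) by (rule compact_continuous_image)
  show "f ` K \<subseteq> \<D>"
    using disc_selfmap_in[OF f] K(2) by blast
qed

lemma disc_selfmap_comp:
  assumes "disc_selfmap f" "disc_selfmap g"
  shows "disc_selfmap (f \<circ> g)"
  unfolding disc_selfmap_def
proof
  show "f \<circ> g holomorphic_on \<D>"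
    using assms by (intro holomorphic_on_compose_gen[of g \<D> f \<D>])
      (auto simp: disc_selfmap_def)
  show "f \<circ> g \<in> \<D> \<rightarrow> \<D>"
    using assms disc_selfmap_in by fastforce
qed

text \<open>The image of a non-constant holomorphic map is open, so if the composition were constant then
  the outer map would be constant on an open set, hence everywhere.\<close>
lemma disc_selfmap_comp_nonconstant:
  assumes f: "disc_selfmap f" "\<not> f constant_on \<D>"
    and g: "disc_selfmap g" "\<not> g constant_on \<D>"
  shows "\<not> (f \<circ> g) constant_on \<D>"
proof
  assume "(f \<circ> g) constant_on \<D>"
  then obtain c where c: "f (g z) = c" if "z \<in> \<D>" for z
    unfolding constant_on_def by auto
  have op: "open (g ` \<D>)"
    using open_mapping_thm[OF disc_selfmap_holomorphic[OF g(1)] open_ball connected_ball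
        open_ball subset_refl g(2)] .
  have "f z = c" if "z \<in> \<D>" for z
  proof (rule analytic_continuation_open[OF op open_ball _ connected_ball _
        disc_selfmap_holomorphic[OF f(1)] holomorphic_on_const _ that])
    show "g ` \<D> \<subseteq> \<D>"
      using disc_selfmap_in[OF g(1)] by blast
  qed (auto simp: c)
  then show False
    using f(2) unfolding constant_on_def by blast
qed

text \<open>Limits of self-maps, and quotients obtained from the Schwarz lemma, a priori take values in
  the closed disc only; the maximum principle brings them back into the open disc.\<close>
lemma disc_selfmap_of_norm_le_1:
  assumes hol: "f holomorphic_on \<D>" and le: "\<And>z. z \<in> \<D> \<Longrightarrow> norm (f z) \<le> 1"
    and nc: "\<not> f constant_on \<D>"
  shows "disc_selfmap f"
proof -
  have "norm (f w) < 1" if w: "w \<in> \<D>" for w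
  proof (rule ccontr)
    assume "\<not> norm (f w) < 1"
    then have "norm (f z) \<le> norm (f w)" if "z \<in> \<D>" for z
      using le[OF that] by simp
    then have "f constant_on \<D>"
      using maximum_modulus_principle[OF hol open_ball connected_ball open_ball subset_refl w]
      by blast
    with nc show False by blast
  qed
  then show ?thesis
    unfolding disc_selfmap_def using hol by auto
qed

lemma disc_automorphism_selfmap: "disc_automorphism f \<Longrightarrow> disc_selfmap f"
  unfolding disc_automorphism_def disc_selfmap_def by (auto simp: bij_betw_def)

lemma disc_automorphism_nonconstant:
  assumes "disc_automorphism f"
  shows "\<not> f constant_on \<D>"
proof
  assume "f constant_on \<D>"
  then have "f 0 = f (1/2)"
    unfolding constant_on_def by force
  then show False
    using assms unfolding disc_automorphism_def bij_betw_def inj_on_def by force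
qed

lemma disc_automorphism_inv_into_left:
  "disc_automorphism f \<Longrightarrow> z \<in> \<D> \<Longrightarrow> inv_into \<D> f (f z) = z"
  unfolding disc_automorphism_def bij_betw_def by (blast intro: inv_into_f_f)

lemma disc_automorphism_inv_into_right:
  "disc_automorphism f \<Longrightarrow> z \<in> \<D> \<Longrightarrow> f (inv_into \<D> f z) = z"
  unfolding disc_automorphism_def bij_betw_def by (blast intro: f_inv_into_f)

lemma disc_automorphism_inv_into:
  assumes "disc_automorphism f"
  shows "disc_automorphism (inv_into \<D> f)"
proof -
  have hol: "f holomorphic_on \<D>" and bij: "bij_betw f \<D> \<D>"
    using assms unfolding disc_automorphism_def by auto
  obtain k where k: "k holomorphic_on (f ` \<D>)" "\<And>z. z \<in> \<D> \<Longrightarrow> k (f z) = z"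
    using holomorphic_has_inverse[OF hol open_ball bij_betw_imp_inj_on[OF bij]] by metis
  have "inv_into \<D> f w = k w" if "w \<in> \<D>" for w
    using k(2)[of "inv_into \<D> f w"] disc_automorphism_inv_into_right[OF assms that]
      bij_betw_apply[OF bij_betw_inv_into[OF bij] that] by simp
  then have "inv_into \<D> f holomorphic_on \<D>"
    using k(1) bij_betw_imp_surj_on[OF bij] holomorphic_cong[of \<D> \<D> "inv_into \<D> f" k] by simp
  then show ?thesis
    unfolding disc_automorphism_def using bij_betw_inv_into[OF bij] by blast
qed

lemma disc_automorphism_comp:
  assumes "disc_automorphism f" "disc_automorphism g"
  shows "disc_automorphism (f \<circ> g)"
  using disc_selfmap_comp[of f g] assms bij_betw_trans[of g \<D> \<D> f \<D>]
  by (auto simp: disc_automorphism_selfmap disc_selfmap_holomorphic disc_automorphism_def)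

lemma disc_automorphism_funpow:
  assumes "disc_automorphism g"
  shows "disc_automorphism (g ^^ n)"
proof (induction n)
  case 0
  show ?case using bij_betw_id[of \<D>] by (auto simp: disc_automorphism_def id_def)
next
  case (Suc n)
  show ?case using disc_automorphism_comp[OF assms Suc] by (simp only: funpow.simps)
qed

lemma compact_in_disc_imp_smaller_cball:
  assumes "compact K" "K \<subseteq> \<D>"
  obtains r where "0 \<le> r" "r < 1" "K \<subseteq> cball 0 r"
proof (cases "K = {}")
  case True
  then show ?thesis using that[of 0] by simp
next
  case False
  obtain x where x: "x \<in> K" "\<forall>y\<in>K. norm y \<le> norm x"
    using continuous_attains_sup[OF assms(1) False, of norm] continuous_on_norm_id by blast
  then show ?thesis
    using that[of "norm x"] assms(2) by (auto simp: subset_iff)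
qed

section \<open>The Schwarz--Pick lemma\<close>

lemma disc_selfmap_Moebius_function:
  assumes "norm c < 1"
  shows "disc_selfmap (Moebius_function 0 c)"
  unfolding disc_selfmap_def
  using Moebius_function_holomorphic[OF assms] Moebius_function_norm_lt_1[OF assms] by auto

text \<open>The Schwarz--Pick lemma in divided form. Composing \<open>F\<close> on both sides with disc
  automorphisms gives a map \<open>v\<close> that fixes \<open>0\<close>; then \<open>v z / z\<close> is holomorphic and bounded by \<open>1\<close> by the
  Schwarz lemma. For the identity map \<open>q = 1\<close>, so \<open>1 - q\<close> measures how far \<open>F\<close> is from the
  identity once the motion of the point \<open>a\<close> has been divided out.\<close>
lemma schwarz_pick_factor:
  assumes F: "disc_selfmap F" and a: "a \<in> \<D>"
  obtains q where "q holomorphic_on \<D>" "\<And>w. w \<in> \<D> \<Longrightarrow> norm (q w) \<le> 1"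
    "\<And>w. w \<in> \<D> \<Longrightarrow> Moebius_function 0 (F a) (F w) = Moebius_function 0 a w * q w"
proof -
  have a1: "norm a < 1" and Fa1: "norm (F a) < 1"
    using a disc_selfmap_norm[OF F] by auto
  define v where "v = Moebius_function 0 (F a) \<circ> (F \<circ> Moebius_function 0 (-a))"
  have v: "disc_selfmap v"
    unfolding v_def using a1 Fa1 by (intro disc_selfmap_comp disc_selfmap_Moebius_function F) auto
  have v0: "v 0 = 0"
    by (simp add: v_def Moebius_function_of_zero Moebius_function_eq_zero)
  have holv: "v holomorphic_on ball 0 1"
    by (rule disc_selfmap_holomorphic[OF v])
  obtain k where k: "k holomorphic_on ball 0 1" "\<And>z. norm z < 1 \<Longrightarrow> v z = z * k z"
      "deriv v 0 = k 0"
    using Schwarz3[OF holv v0] by metis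
  have kle: "norm (k z) \<le> 1" if z: "norm z < 1" for z
  proof (cases "z = 0")
    case True
    then show ?thesis
      using Schwarz_Lemma(2)[OF holv v0 disc_selfmap_norm[OF v] z] k(3) by simp
  next
    case False
    then show ?thesis
      using Schwarz_Lemma(1)[OF holv v0 disc_selfmap_norm[OF v] z] k(2)[OF z]
      by (simp add: norm_mult)
  qed
  show thesis
  proof
    show "k \<circ> Moebius_function 0 a holomorphic_on \<D>"
      using k(1) Moebius_function_holomorphic[OF a1] Moebius_function_norm_lt_1[OF a1]
      by (intro holomorphic_on_compose_gen[where t = \<D>]) auto
    fix w assume "w \<in> \<D>"
    then have w: "norm w < 1" by simp
    note Tw = Moebius_function_norm_lt_1[OF a1 w, of 0]
    show "norm ((k \<circ> Moebius_function 0 a) w) \<le> 1"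
      using kle[OF Tw] by simp
    have "Moebius_function 0 (-a) (Moebius_function 0 a w) = w"
      using a1 w by (intro Moebius_function_compose) auto
    then show "Moebius_function 0 (F a) (F w)
        = Moebius_function 0 a w * (k \<circ> Moebius_function 0 a) w"
      using k(2)[OF Tw] by (simp add: v_def)
  qed
qed

text \<open>Contraction of the pseudo-hyperbolic distance, multiplied out on the side of the image points,
  which is the form that the estimates below use.\<close>
lemma schwarz_pick:
  assumes F: "disc_selfmap F" and x: "x \<in> \<D>" and y: "y \<in> \<D>"
  shows "norm (F y - F x) \<le> norm (Moebius_function 0 x y) * norm (1 - cnj (F x) * F y)"
proof -
  obtain q where q: "\<And>w. w \<in> \<D> \<Longrightarrow> norm (q w) \<le> 1"
      "\<And>w. w \<in> \<D> \<Longrightarrow> Moebius_function 0 (F x) (F w) = Moebius_function 0 x w * q w"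
    using schwarz_pick_factor[OF F x] by metis
  have nz: "1 - cnj (F x) * F y \<noteq> 0"
    using disc_selfmap_in[OF F x] disc_selfmap_in[OF F y] by (intro pick_norm(1)) auto
  have "norm (F y - F x)
      = norm (Moebius_function 0 (F x) (F y)) * norm (1 - cnj (F x) * F y)"
    using nz by (simp add: Moebius_function_simple norm_divide)
  also have "\<dots> \<le> norm (Moebius_function 0 x y) * norm (1 - cnj (F x) * F y)"
    using q(1)[OF y] by (intro mult_right_mono) (auto simp: q(2)[OF y] norm_mult mult_left_le)
  finally show ?thesis .
qed

lemma norm_one_minus_cnj_mult_ge:
  assumes "norm x < 1" "norm y < 1"
  shows "1 - norm x \<le> norm (1 - cnj x * y)"
proof -
  have "norm (cnj x * y) \<le> norm x"
    using assms by (simp add: norm_mult mult_left_le)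
  then show ?thesis
    using norm_triangle_ineq2[of 1 "cnj x * y"] by simp
qed

lemma norm_one_minus_cnj_mult_le:
  assumes "norm x < 1" "norm y < 1"
  shows "norm (1 - cnj x * y) \<le> 2"
  using norm_triangle_ineq4[of 1 "cnj x * y"] norm_mult_less[of "cnj x" 1 y 1] assms by simp

text \<open>The constant depends neither on \<open>F\<close> nor on \<open>y\<close>, which may lie arbitrarily close to the unit
  circle. This uniformity is what makes compositions of unboundedly many maps tractable.\<close>
lemma disc_selfmap_lipschitz:
  assumes F: "disc_selfmap F" and x: "x \<in> \<D>" and y: "y \<in> \<D>"
  shows "norm (F y - F x) \<le> 2 / (1 - norm x) * norm (y - x)"
proof -
  have "norm (Moebius_function 0 x y) = norm (y - x) / norm (1 - cnj x * y)"
    by (simp add: Moebius_function_simple norm_divide)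
  also have "\<dots> \<le> norm (y - x) / (1 - norm x)"
    using norm_one_minus_cnj_mult_ge[of x y] x y by (intro divide_left_mono mult_pos_pos) auto
  finally have T: "norm (Moebius_function 0 x y) \<le> norm (y - x) / (1 - norm x)" .
  have "norm (F y - F x) \<le> norm (Moebius_function 0 x y) * norm (1 - cnj (F x) * F y)"
    by (rule schwarz_pick[OF assms])
  also have "\<dots> \<le> norm (y - x) / (1 - norm x) * 2"
    using T x disc_selfmap_in[OF F x] disc_selfmap_in[OF F y]
    by (intro mult_mono norm_one_minus_cnj_mult_le) auto
  finally show ?thesis by (simp add: mult.commute)
qed

text \<open>With this comparison the hyperbolic hypotheses become Euclidean ones, and all later estimates
  are Euclidean.\<close>
lemma norm_diff_le_hyp_dist:
  assumes "x \<in> \<D>" "y \<in> \<D>"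
  shows "norm (x - y) \<le> 2 * hyp_dist x y"
proof -
  have x: "norm x < 1" and y: "norm y < 1" using assms by auto
  define r where "r = norm ((y - x) / (1 - cnj x * y))"
  have r: "0 \<le> r" "r < 1"
    using pick_less[OF x y] by (auto simp: r_def)
  have "r \<le> ln ((1 + r) / (1 - r))"
  proof -
    \<comment> \<open>The hyperbolic distance is twice the artanh of the pseudo-hyperbolic distance \<open>r\<close>.\<close>
    have "ln (1 - r) \<le> - r"
      using ln_le_minus_one[of "1 - r"] r by simp
    moreover have "0 \<le> ln (1 + r)"
      using r by simp
    moreover have "ln ((1 + r) / (1 - r)) = ln (1 + r) - ln (1 - r)"
      using r by (simp add: ln_div)
    ultimately show ?thesis by linarith
  qed
  then have "r \<le> hyp_dist x y"
    using hyp_dist_eq_ln[OF x y r_def] by simp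
  moreover have "norm (x - y) = r * norm (1 - cnj x * y)"
    using pick_norm(1)[OF x y] by (simp add: r_def norm_divide norm_minus_commute)
  ultimately show ?thesis
    using mult_left_mono[OF norm_one_minus_cnj_mult_le[OF x y] r(1)] by simp
qed

section \<open>Self-maps that almost fix two points\<close>

text \<open>Joint Lipschitz continuity in the parameter and in the argument. Only the parameters have to
  stay away from the unit circle, since the denominator \<open>1 - cnj x * y\<close> is at least \<open>1 - norm x\<close> in
  absolute value whatever \<open>y\<close> is.\<close>
lemma Moebius_function_lipschitz:
  assumes "norm x < 1" "norm y < 1" "norm x' < 1" "norm y' < 1"
  shows "norm (Moebius_function 0 x y - Moebius_function 0 x' y')
    \<le> 4 * (norm (x - x') + norm (y - y')) / ((1 - norm x) * (1 - norm x'))"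
proof -
  define p where "p = 1 - cnj x * y"
  define p' where "p' = 1 - cnj x' * y'"
  have p: "1 - norm x \<le> norm p" and p': "1 - norm x' \<le> norm p'" "norm p' \<le> 2"
    unfolding p_def p'_def
    using assms norm_one_minus_cnj_mult_ge norm_one_minus_cnj_mult_le by auto
  have "norm p > 0" "norm p' > 0"
    using p p' assms by linarith+
  then have nz: "p \<noteq> 0" "p' \<noteq> 0"
    by auto
  let ?\<delta> = "norm (x - x') + norm (y - y')"
  have pp': "norm (p' - p) \<le> ?\<delta>"
  proof -
    have "p' - p = cnj x * (y - y') + cnj (x - x') * y'"
      by (simp add: p_def p'_def algebra_simps)
    then have "norm (p' - p) \<le> norm x * norm (y - y') + norm (x - x') * norm y'"
      using norm_triangle_ineq[of "cnj x * (y - y')" "cnj (x - x') * y'"]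
      by (simp only: norm_mult complex_mod_cnj)
    also have "\<dots> \<le> 1 * norm (y - y') + norm (x - x') * 1"
      using assms by (intro add_mono mult_mono) auto
    finally show ?thesis by simp
  qed
  have "Moebius_function 0 x y - Moebius_function 0 x' y'
      = ((y - x) * p' - (y' - x') * p) / (p * p')"
    using nz by (simp add: Moebius_function_simple p_def[symmetric] p'_def[symmetric]
        diff_frac_eq)
  also have "(y - x) * p' - (y' - x') * p
      = ((y - y') - (x - x')) * p' + (y' - x') * (p' - p)"
    by (simp add: algebra_simps)
  finally have "norm (Moebius_function 0 x y - Moebius_function 0 x' y')
      = norm (((y - y') - (x - x')) * p' + (y' - x') * (p' - p)) / (norm p * norm p')"
    by (simp add: norm_divide norm_mult)
  also have "\<dots> \<le> 4 * ?\<delta> / ((1 - norm x) * (1 - norm x'))"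
  proof (rule frac_le)
    have "norm (((y - y') - (x - x')) * p' + (y' - x') * (p' - p))
        \<le> norm ((y - y') - (x - x')) * norm p' + norm (y' - x') * norm (p' - p)"
      by (metis norm_mult norm_triangle_ineq)
    also have "\<dots> \<le> ?\<delta> * 2 + 2 * ?\<delta>"
    proof (intro add_mono mult_mono p' pp')
      show "norm ((y - y') - (x - x')) \<le> ?\<delta>"
        using norm_triangle_ineq4[of "y - y'" "x - x'"] by simp
      show "norm (y' - x') \<le> 2"
        using norm_triangle_ineq4[of y' x'] assms by simp
    qed auto
    finally show "norm (((y - y') - (x - x')) * p' + (y' - x') * (p' - p)) \<le> 4 * ?\<delta>"
      by simp
    show "(1 - norm x) * (1 - norm x') \<le> norm p * norm p'"
      using p p' assms by (intro mult_mono) auto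
  qed (use assms in auto)
  finally show ?thesis .
qed

text \<open>A Harnack-type inequality: a map into the closed disc that is close to the boundary point \<open>1\<close>
  at \<open>b\<close> is equally close to it, up to a constant factor, on hyperbolic discs about \<open>b\<close>. Substituting
  \<open>q = 1 - p\<close> into the Schwarz--Pick inequality makes its right-hand side of first order in \<open>p\<close>, so
  that the inequality can be solved for \<open>norm (p w)\<close>.\<close>
lemma norm_one_minus_bounded_holomorphic_le:
  assumes q: "q holomorphic_on \<D>" "\<And>w. w \<in> \<D> \<Longrightarrow> norm (q w) \<le> 1"
    and b: "b \<in> \<D>" and w: "w \<in> \<D>"
    and d: "norm (Moebius_function 0 b w) \<le> d" "d < 1"
  shows "norm (1 - q w) \<le> 2 / (1 - d) * norm (1 - q b)"
proof -
  let ?s = "1 - q b" and ?p = "1 - q w"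
  have d0: "0 \<le> d"
    using d(1) norm_ge_zero order_trans by blast
  have step: "norm (q w - q b) \<le> d * norm (1 - cnj (q b) * q w)"
  proof (cases "q constant_on \<D>")
    case True
    then have "q w = q b"
      using b w unfolding constant_on_def by auto
    then show ?thesis using d0 by simp
  next
    case False
    then have "disc_selfmap q"
      using disc_selfmap_of_norm_le_1 q by blast
    from schwarz_pick[OF this b w] show ?thesis
      using mult_right_mono[OF d(1), of "norm (1 - cnj (q b) * q w)"] by simp
  qed
  \<comment> \<open>The constant terms cancel here, so this factor is small when \<open>q\<close> is near \<open>1\<close>.\<close>
  have "1 - cnj (q b) * q w = ?p + cnj ?s * q w"
    by (simp add: algebra_simps)
  then have "norm (1 - cnj (q b) * q w) \<le> norm ?p + norm ?s * norm (q w)"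
    using norm_triangle_ineq[of ?p "cnj ?s * q w"] by (simp only: norm_mult complex_mod_cnj)
  also have "\<dots> \<le> norm ?p + norm ?s"
    using q(2)[OF w] by (simp add: mult_left_le)
  finally have "norm (q w - q b) \<le> d * (norm ?p + norm ?s)"
    using step mult_left_mono[OF _ d0] by (meson order_trans)
  moreover have "norm ?p - norm ?s \<le> norm (q w - q b)"
    using norm_triangle_ineq2[of ?p ?s] by (simp add: norm_minus_commute)
  moreover have "d * norm ?s \<le> norm ?s"
    using d(2) by (simp add: mult_left_le_one_le d0)
  ultimately have "(1 - d) * norm ?p \<le> 2 * norm ?s"
    using norm_ge_zero[of ?s] by (simp only: left_diff_distrib distrib_left)
  then show ?thesis
    using d(2) by (simp add: field_simps)
qed

text \<open>Linear stability of the rule that a self-map fixing two points is the identity. In the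
  factorization of \<open>u\<close> at \<open>a\<close>, almost fixing \<open>a\<close> and \<open>b\<close> forces the quotient \<open>q\<close> to be near \<open>1\<close> at
  \<open>b\<close>; the Harnack-type inequality spreads this over \<open>K\<close>, and undoing the two Moebius
  transformations gives the displacement of \<open>u\<close>. Every step loses only a constant factor. It
  is essential that the bound is linear in the displacements of \<open>a\<close> and \<open>b\<close>, because it must turn
  summable displacements into summable ones.\<close>
lemma disc_selfmap_near_identity:
  assumes a: "a \<in> \<D>" and b: "b \<in> \<D>" and ab: "a \<noteq> b" and K: "compact K" "K \<subseteq> \<D>"
  obtains C where "\<And>u w. disc_selfmap u \<Longrightarrow> w \<in> K \<Longrightarrow>
    norm (u w - w) \<le> C * (norm (u a - a) + norm (u b - b))"
proof -
  have a1: "norm a < 1" and b1: "norm b < 1" using a b by auto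
  define A where "A = 1 - norm a"
  have A: "A > 0" using a1 by (simp add: A_def)
  define \<kappa> where "\<kappa> = norm (Moebius_function 0 a b)"
  have \<kappa>: "\<kappa> > 0"
    using pick_norm(1)[OF a1 b1] ab by (simp add: \<kappa>_def Moebius_function_simple)
  obtain d where d: "d < 1" "\<And>w. w \<in> K \<Longrightarrow> norm (Moebius_function 0 b w) \<le> d"
    using compact_in_disc_imp_smaller_cball[OF
        disc_selfmap_compact_image[OF disc_selfmap_Moebius_function[OF b1] K]]
    by (metis image_subset_iff mem_cball_0)
  define S where "S = 16 / (A\<^sup>2 * \<kappa> * (1 - d))"
  define C where "C = max (4 / A) (8 * (1 + S) / A\<^sup>2)"
  show thesis
  proof
    fix u w assume u: "disc_selfmap u" and w: "w \<in> K"
    define \<epsilon> where "\<epsilon> = norm (u a - a) + norm (u b - b)"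
    have \<epsilon>0: "\<epsilon> \<ge> 0" by (simp add: \<epsilon>_def)
    have w1: "norm w < 1" using w K by auto
    note u1 = disc_selfmap_norm[OF u]
    show "norm (u w - w) \<le> C * (norm (u a - a) + norm (u b - b))"
      unfolding \<epsilon>_def[symmetric]
    proof (cases "\<epsilon> \<le> A / 2")
      \<comment> \<open>For large displacements the bound is trivial, as no point moves by more than \<open>2\<close>;
        otherwise \<open>u a\<close> keeps a definite distance from the unit circle.\<close>
      case False
      then have "2 \<le> 4 / A * \<epsilon>"
        using A by (simp add: field_simps)
      also have "\<dots> \<le> C * \<epsilon>"
        by (intro mult_right_mono \<epsilon>0) (simp add: C_def)
      finally show "norm (u w - w) \<le> C * \<epsilon>"
        using norm_triangle_ineq4[of "u w" w] u1[OF w1] w1 by simp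
    next
      case True
      have ua: "A / 2 \<le> 1 - norm (u a)"
        using norm_triangle_ineq2[of "u a" a] True by (simp add: \<epsilon>_def A_def)
          (use norm_ge_zero[of "u b - b"] in argo)
      have den: "A\<^sup>2 / 2 \<le> (1 - norm a) * (1 - norm (u a))"
        using mult_left_mono[OF ua, of A] A by (simp add: A_def power2_eq_square)
      obtain q where q: "q holomorphic_on \<D>" "\<And>w. w \<in> \<D> \<Longrightarrow> norm (q w) \<le> 1"
          "\<And>w. w \<in> \<D> \<Longrightarrow> Moebius_function 0 (u a) (u w) = Moebius_function 0 a w * q w"
        using schwarz_pick_factor[OF u a] by metis
      \<comment> \<open>Exact comparison of \<open>u\<close>, seen from \<open>u a\<close>, with the identity, seen from \<open>a\<close>. It is used
        twice: at \<open>b\<close> to bound \<open>1 - q b\<close>, and at \<open>w\<close> to go back from \<open>q\<close> to \<open>u\<close>.\<close>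
      have eqd: "norm (Moebius_function 0 a z - Moebius_function 0 (u a) (u z))
          = norm (Moebius_function 0 a z) * norm (1 - q z)" if "z \<in> \<D>" for z
        using q(3)[OF that] by (metis mult.right_neutral norm_mult right_diff_distrib)
      have "\<kappa> * norm (1 - q b) \<le> 4 * (norm (a - u a) + norm (b - u b))
          / ((1 - norm a) * (1 - norm (u a)))"
        using Moebius_function_lipschitz[OF a1 b1 u1[OF a1] u1[OF b1]] eqd[OF b]
        by (simp add: \<kappa>_def)
      also have "\<dots> \<le> 4 * \<epsilon> / (A\<^sup>2 / 2)"
        using A den \<epsilon>0 by (intro frac_le) (auto simp: \<epsilon>_def norm_minus_commute)
      finally have qb: "norm (1 - q b) \<le> 8 * \<epsilon> / (A\<^sup>2 * \<kappa>)"
        using \<kappa> A by (simp add: field_simps)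
      have "norm (1 - q w) \<le> 2 / (1 - d) * norm (1 - q b)"
        using norm_one_minus_bounded_holomorphic_le[OF q(1,2) b _ d(2)[OF w] d(1)] w1 by simp
      also have "\<dots> \<le> 2 / (1 - d) * (8 * \<epsilon> / (A\<^sup>2 * \<kappa>))"
        using d(1) by (intro mult_left_mono qb) auto
      also have "\<dots> = S * \<epsilon>"
        by (simp add: S_def)
      finally have qw: "norm (1 - q w) \<le> S * \<epsilon>" .
      let ?x = "Moebius_function 0 a w" and ?y = "Moebius_function 0 (u a) (u w)"
      have x1: "norm ?x < 1" and y1: "norm ?y < 1"
        using Moebius_function_norm_lt_1 a1 w1 u1 by auto
      have xy: "norm (?x - ?y) \<le> S * \<epsilon>"
        using eqd[of w] w1 x1 qw mult_left_le_one_le[of "norm (1 - q w)" "norm ?x"] by simp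
      have inv: "Moebius_function 0 (-a) ?x = w" "Moebius_function 0 (- u a) ?y = u w"
        using a1 w1 u1 by (simp_all add: Moebius_function_compose)
      have "norm (w - u w) \<le> 4 * (norm (- a - - u a) + norm (?x - ?y))
          / ((1 - norm (- a)) * (1 - norm (- u a)))"
        using Moebius_function_lipschitz[of "-a" ?x "- u a" ?y] a1 u1[OF a1] x1 y1 inv by simp
      also have "\<dots> \<le> 4 * (\<epsilon> + S * \<epsilon>) / (A\<^sup>2 / 2)"
      proof (rule frac_le)
        have "norm (- a - - u a) \<le> \<epsilon>"
          by (simp add: \<epsilon>_def)
        then show "4 * (norm (- a - - u a) + norm (?x - ?y)) \<le> 4 * (\<epsilon> + S * \<epsilon>)"
          using xy by simp
        have "0 \<le> S * \<epsilon>" using xy norm_ge_zero order_trans by blast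
        then show "0 \<le> 4 * (\<epsilon> + S * \<epsilon>)" using \<epsilon>0 by simp
      qed (use A den in auto)
      also have "\<dots> = 8 * (1 + S) / A\<^sup>2 * \<epsilon>"
        by (simp add: algebra_simps)
      also have "\<dots> \<le> C * \<epsilon>"
        by (intro mult_right_mono \<epsilon>0) (simp add: C_def)
      finally show "norm (u w - w) \<le> C * \<epsilon>"
        by (simp add: norm_minus_commute)
    qed
  qed
qed

section \<open>Inner compositions of maps close to the identity\<close>

lemma disc_selfmap_inner_comp:
  assumes "\<And>n. disc_selfmap (h (Suc n))"
  shows "disc_selfmap (inner_comp h n)"
proof (induction n)
  case 0
  show ?case by (auto simp: disc_selfmap_def)
next
  case (Suc n)
  show ?case using disc_selfmap_comp[OF Suc assms[of n]] by (simp only: inner_comp.simps)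
qed

lemma inner_comp_nonconstant:
  assumes "\<And>n. disc_selfmap (h (Suc n))" "\<And>n. \<not> h (Suc n) constant_on \<D>"
  shows "\<not> inner_comp h n constant_on \<D>"
proof (induction n)
  case 0
  show ?case
    using disc_automorphism_nonconstant[of id] bij_betw_id[of \<D>]
    by (simp only: inner_comp.simps disc_automorphism_def holomorphic_on_id simp_thms)
next
  case (Suc n)
  show ?case
    unfolding inner_comp.simps
    by (rule disc_selfmap_comp_nonconstant[OF disc_selfmap_inner_comp[of h, OF assms(1)] Suc
        assms(1,2)[of n]])
qed

lemma inner_comp_add:
  "inner_comp h (m + n) = inner_comp h m \<circ> inner_comp (\<lambda>k. h (m + k)) n"
  by (induction n) (auto simp: o_assoc)

text \<open>The new map acts first in an inner composition, so one more factor only perturbs the argument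
  of a self-map, and the uniform Lipschitz bound applies.\<close>
lemma inner_comp_step_bound:
  assumes h: "\<And>n. disc_selfmap (h (Suc n))" and z: "z \<in> \<D>"
  shows "norm (inner_comp h (Suc n) z - inner_comp h n z)
    \<le> 2 / (1 - norm z) * norm (h (Suc n) z - z)"
  using disc_selfmap_lipschitz[OF disc_selfmap_inner_comp[of h, OF h] z disc_selfmap_in[OF h z]]
  by simp

text \<open>By the step bound the telescoping series of the compositions is dominated by the displacements
  of the factors. Besides convergence, the displacement of the limit is recorded: applied to a
  tail of the sequence it shows that the limit is close to the identity.\<close>
lemma inner_comp_converges:
  assumes h: "\<And>n. disc_selfmap (h (Suc n))"
    and close: "\<And>K. compact K \<Longrightarrow> K \<subseteq> \<D> \<Longrightarrow>
      \<exists>M. summable M \<and> (\<forall>n. \<forall>z\<in>K. norm (h (Suc n) z - z) \<le> M n)"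
  obtains F where "F holomorphic_on \<D>" "\<And>z. z \<in> \<D> \<Longrightarrow> norm (F z) \<le> 1"
    "\<And>K. compact K \<Longrightarrow> K \<subseteq> \<D> \<Longrightarrow> uniform_limit K (inner_comp h) F sequentially"
    "\<And>z. z \<in> \<D> \<Longrightarrow> norm (F z - z) \<le> 2 / (1 - norm z) * (\<Sum>n. norm (h (Suc n) z - z))"
proof -
  let ?H = "inner_comp h"
  define F where "F = (\<lambda>z. z + (\<Sum>n. ?H (Suc n) z - ?H n z))"
  note sm = disc_selfmap_inner_comp[of h, OF h]
  have ul: "uniform_limit K ?H F sequentially" if K: "compact K" "K \<subseteq> \<D>" for K
  proof -
    obtain r where r: "0 \<le> r" "r < 1" "K \<subseteq> cball 0 r"
      using compact_in_disc_imp_smaller_cball[OF K] .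
    obtain M where M: "summable M" "\<And>n z. z \<in> K \<Longrightarrow> norm (h (Suc n) z - z) \<le> M n"
      using close[OF K] by blast
    have "norm (?H (Suc n) z - ?H n z) \<le> 2 / (1 - r) * M n" if z: "z \<in> K" for n z
    proof -
      have "norm (?H (Suc n) z - ?H n z) \<le> 2 / (1 - norm z) * norm (h (Suc n) z - z)"
        using inner_comp_step_bound[of h, OF h] z K by blast
      also have "\<dots> \<le> 2 / (1 - r) * M n"
        using r z M(2)[OF z] by (intro mult_mono divide_left_mono mult_pos_pos) auto
      finally show ?thesis .
    qed
    then have "uniform_limit K (\<lambda>n z. \<Sum>i<n. ?H (Suc i) z - ?H i z)
        (\<lambda>z. \<Sum>i. ?H (Suc i) z - ?H i z) sequentially"
      by (rule Weierstrass_m_test) (use M in \<open>auto intro: summable_mult\<close>)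
    then have "uniform_limit K (\<lambda>n z. z + (\<Sum>i<n. ?H (Suc i) z - ?H i z)) F sequentially"
      unfolding F_def by (intro uniform_limit_add uniform_limit_intros)
    moreover have "z + (\<Sum>i<n. ?H (Suc i) z - ?H i z) = ?H n z" for n z
      using sum_lessThan_telescope[of "\<lambda>i. ?H i z" n] by simp
    ultimately show ?thesis by simp
  qed
  have lim: "(\<lambda>n. ?H n z) \<longlonglongrightarrow> F z" if "z \<in> \<D>" for z
    using tendsto_uniform_limitI[OF ul[of "{z}"]] that by simp
  show thesis
  proof
    show "F holomorphic_on \<D>"
    proof (rule holomorphic_uniform_sequence[OF open_ball])
      show "?H n holomorphic_on \<D>" for n
        using disc_selfmap_holomorphic[OF sm] .
      fix x assume "x \<in> \<D>"
      then obtain d where d: "d > 0" "cball x d \<subseteq> \<D>"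
        using open_contains_cball_eq[OF open_ball] by blast
      show "\<exists>d>0. cball x d \<subseteq> \<D> \<and> uniform_limit (cball x d) ?H F sequentially"
        using d ul[OF compact_cball d(2)] by blast
    qed
    show "norm (F z) \<le> 1" if z: "z \<in> \<D>" for z
      using disc_selfmap_norm[OF sm] z
      by (intro tendsto_upperbound[OF tendsto_norm[OF lim[OF z]]])
        (auto intro!: always_eventually less_imp_le)
    show "uniform_limit K ?H F sequentially" if "compact K" "K \<subseteq> \<D>" for K
      using ul that .
    fix z assume z: "z \<in> \<D>"
    have "\<exists>M. summable M \<and> (\<forall>n. norm (h (Suc n) z - z) \<le> M n)"
      using close[of "{z}"] z by simp
    then obtain M where M: "summable M" "\<forall>n. norm (h (Suc n) z - z) \<le> M n"
      by (elim exE conjE)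
    have s: "summable (\<lambda>n. norm (h (Suc n) z - z))"
      by (rule summable_comparison_test'[OF M(1), of 0]) (use M(2) in simp)
    have le: "norm (?H n z - z) \<le> 2 / (1 - norm z) * (\<Sum>n. norm (h (Suc n) z - z))" for n
    proof -
      have "norm (?H n z - z) = norm (\<Sum>i<n. ?H (Suc i) z - ?H i z)"
        using sum_lessThan_telescope[of "\<lambda>i. ?H i z" n] by simp
      also have "\<dots> \<le> (\<Sum>i<n. 2 / (1 - norm z) * norm (h (Suc i) z - z))"
        using inner_comp_step_bound[of h, OF h z] by (rule sum_norm_le)
      also have "\<dots> = 2 / (1 - norm z) * (\<Sum>i<n. norm (h (Suc i) z - z))"
        by (simp add: sum_distrib_left)
      also have "\<dots> \<le> 2 / (1 - norm z) * (\<Sum>n. norm (h (Suc n) z - z))"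
        using z by (intro mult_left_mono sum_le_suminf s) auto
      finally show ?thesis .
    qed
    have "(\<lambda>n. norm (?H n z - z)) \<longlonglongrightarrow> norm (F z - z)"
      using lim[OF z] by (intro tendsto_intros)
    from tendsto_upperbound[OF this always_eventually]
    show "norm (F z - z) \<le> 2 / (1 - norm z) * (\<Sum>n. norm (h (Suc n) z - z))"
      using le by simp
  qed
qed

text \<open>A limit of non-constant maps may be constant, so the compositions are split as a finite part
  \<open>P\<close>, which is non-constant, followed on the inside by a tail whose limit \<open>T\<close> is so close to the
  identity that it separates \<open>0\<close> and \<open>1/2\<close>.\<close>
lemma inner_comp_converges_nonconstant:
  assumes h: "\<And>n. disc_selfmap (h (Suc n))"
    and nc: "\<And>n. \<not> h (Suc n) constant_on \<D>"
    and close: "\<And>K. compact K \<Longrightarrow> K \<subseteq> \<D> \<Longrightarrow>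
      \<exists>M. summable M \<and> (\<forall>n. \<forall>z\<in>K. norm (h (Suc n) z - z) \<le> M n)"
  obtains F where "disc_selfmap F" "\<not> F constant_on \<D>"
    "\<And>K. compact K \<Longrightarrow> K \<subseteq> \<D> \<Longrightarrow> uniform_limit K (inner_comp h) F sequentially"
proof -
  obtain F where F: "F holomorphic_on \<D>" "\<And>z. z \<in> \<D> \<Longrightarrow> norm (F z) \<le> 1"
    "\<And>K. compact K \<Longrightarrow> K \<subseteq> \<D> \<Longrightarrow> uniform_limit K (inner_comp h) F sequentially"
    using inner_comp_converges[of h, OF h close] by metis
  obtain M where M: "summable M" "\<And>n z. z \<in> {0, 1/2} \<Longrightarrow> norm (h (Suc n) z - z) \<le> M n"
  proof -
    have "compact {0, 1/2 :: complex}" "{0, 1/2} \<subseteq> \<D>"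
      by auto
    from close[OF this] show thesis
      using that by blast
  qed
  \<comment> \<open>On the two test points the Lipschitz factor \<open>2 / (1 - norm z)\<close> is at most \<open>4\<close>, so that each
    moves by less than \<open>1/4\<close>, half of their distance.\<close>
  obtain m where m: "norm (\<Sum>i. M (i + m)) < 1/16"
    using suminf_exist_split[of "1/16" M] M(1) by auto
  define k where "k = (\<lambda>n. h (m + n))"
  have k: "disc_selfmap (k (Suc n))" for n
    using h[of "m + n"] by (simp add: k_def)
  have "\<exists>M. summable M \<and> (\<forall>n. \<forall>z\<in>K. norm (k (Suc n) z - z) \<le> M n)"
    if K: "compact K" "K \<subseteq> \<D>" for K
  proof -
    obtain M where M: "summable M" "\<And>n z. z \<in> K \<Longrightarrow> norm (h (Suc n) z - z) \<le> M n"
      using close[OF K] by blast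
    show ?thesis
      using M(2)[of _ "m + _"] summable_ignore_initial_segment[OF M(1), of m]
      by (intro exI[of _ "\<lambda>n. M (n + m)"]) (auto simp: k_def add.commute)
  qed
  then obtain T where T: "T holomorphic_on \<D>" "\<And>z. z \<in> \<D> \<Longrightarrow> norm (T z) \<le> 1"
    "\<And>K. compact K \<Longrightarrow> K \<subseteq> \<D> \<Longrightarrow> uniform_limit K (inner_comp k) T sequentially"
    "\<And>z. z \<in> \<D> \<Longrightarrow> norm (T z - z) \<le> 2 / (1 - norm z) * (\<Sum>n. norm (k (Suc n) z - z))"
    using inner_comp_converges[of k, OF k] by metis
  have near: "norm (T z - z) < 1/4" if z: "z \<in> {0, 1/2}" for z
  proof -
    have "\<forall>x\<in>{0, 1/2 :: complex}. norm x \<le> 1/2"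
      by (simp add: norm_divide)
    then have z2: "norm z \<le> 1/2"
      using z by (rule bspec)
    have sM: "summable (\<lambda>n. M (n + m))"
      using M(1) by (rule summable_ignore_initial_segment)
    have le: "norm (k (Suc n) z - z) \<le> M (n + m)" for n
      using M(2)[OF z, of "m + n"] by (simp add: k_def add.commute)
    have "(\<Sum>n. norm (k (Suc n) z - z)) \<le> (\<Sum>n. M (n + m))"
      by (intro suminf_le sM summable_comparison_test'[OF sM, of 0] le) (use le in auto)
    then have lt: "(\<Sum>n. norm (k (Suc n) z - z)) < 1/16"
      using m by simp
    have pos: "0 \<le> (\<Sum>n. norm (k (Suc n) z - z))"
      by (intro suminf_nonneg summable_comparison_test'[OF sM, of 0]) (use le in auto)
    have "norm (T z - z) \<le> 2 / (1 - norm z) * (\<Sum>n. norm (k (Suc n) z - z))"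
      using z2 by (intro T(4)) simp
    also have "\<dots> \<le> 4 * (\<Sum>n. norm (k (Suc n) z - z))"
      using z2 pos by (intro mult_right_mono) (auto simp: field_simps)
    finally show ?thesis using lt by simp
  qed
  have Tnc: "\<not> T constant_on \<D>"
  proof
    assume "T constant_on \<D>"
    then have eq: "T 0 = T (1/2)"
      unfolding constant_on_def by force
    have "norm (1/2 :: complex) \<le> norm (T 0 - 0) + norm (T (1/2) - 1/2)"
      using norm_triangle_ineq4[of "T 0 - 0" "T (1/2) - 1/2"] eq by simp
    then show False
      using near[of 0] near[of "1/2"] by simp
  qed
  have Tsm: "disc_selfmap T"
    using disc_selfmap_of_norm_le_1[OF T(1,2) Tnc] .
  let ?P = "inner_comp h m"
  have P: "disc_selfmap ?P" "\<not> ?P constant_on \<D>"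
    using disc_selfmap_inner_comp[of h, OF h] inner_comp_nonconstant[of h, OF h nc] by auto
  have eq: "F z = (?P \<circ> T) z" if z: "z \<in> \<D>" for z
  proof -
    have "(\<lambda>n. inner_comp h n z) \<longlonglongrightarrow> F z"
      using tendsto_uniform_limitI[OF F(3)[of "{z}"]] z by simp
    then have "(\<lambda>n. inner_comp h (m + n) z) \<longlonglongrightarrow> F z"
      using LIMSEQ_ignore_initial_segment[of _ "F z" m] by (simp add: add.commute)
    then have 1: "(\<lambda>n. ?P (inner_comp k n z)) \<longlonglongrightarrow> F z"
      by (simp add: inner_comp_add k_def)
    have "(\<lambda>n. inner_comp k n z) \<longlonglongrightarrow> T z"
      using tendsto_uniform_limitI[OF T(3)[of "{z}"]] z by simp
    moreover have "isCont ?P (T z)"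
      using disc_selfmap_holomorphic[OF P(1)] disc_selfmap_in[OF Tsm z]
      by (meson continuous_on_eq_continuous_at holomorphic_on_imp_continuous_on open_ball)
    ultimately have 2: "(\<lambda>n. ?P (inner_comp k n z)) \<longlonglongrightarrow> ?P (T z)"
      by (rule isCont_tendsto_compose[rotated])
    show ?thesis
      using LIMSEQ_unique[OF 1 2] by simp
  qed
  have "\<not> F constant_on \<D>"
    using disc_selfmap_comp_nonconstant[OF P Tsm Tnc] eq by (simp add: constant_on_def)
  then show thesis
    using that disc_selfmap_of_norm_le_1[OF F(1,2)] F(3) by blast
qed

section \<open>Removing the elliptic motion\<close>

text \<open>An elliptic map preserves the hyperbolic discs about its fixed point, which are the images of
  round discs about \<open>0\<close> under the conjugation, and these exhaust the unit disc.\<close>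
lemma disc_elliptic_invariant_compact:
  assumes g: "(\<forall>z\<in>\<D>. g z = z) \<or> disc_elliptic g" and K: "compact K" "K \<subseteq> \<D>"
  obtains L where "compact L" "K \<subseteq> L" "L \<subseteq> \<D>" "g ` L = L"
  using g
proof
  assume "\<forall>z\<in>\<D>. g z = z"
  then have "g ` K = K" using K by force
  then show thesis using that K by blast
next
  assume "disc_elliptic g"
  then obtain \<phi> c where \<phi>: "disc_automorphism \<phi>" and c: "norm c = 1"
    and gc: "\<And>z. z \<in> \<D> \<Longrightarrow> g z = inv_into \<D> \<phi> (c * \<phi> z)"
    unfolding disc_elliptic_def by blast
  let ?\<psi> = "inv_into \<D> \<phi>"
  have \<psi>: "disc_selfmap ?\<psi>"
    using disc_automorphism_selfmap[OF disc_automorphism_inv_into[OF \<phi>]] .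
  obtain r where r: "r < 1" "\<phi> ` K \<subseteq> cball 0 r"
    using compact_in_disc_imp_smaller_cball[OF
        disc_selfmap_compact_image[OF disc_automorphism_selfmap[OF \<phi>] K]] .
  have cb: "cball 0 r \<subseteq> \<D>" using r(1) by auto
  define L where "L = ?\<psi> ` cball 0 r"
  have g\<psi>: "g (?\<psi> x) = ?\<psi> (c * x)" if "x \<in> cball 0 r" for x
    using gc[of "?\<psi> x"] disc_selfmap_in[OF \<psi>, of x] disc_automorphism_inv_into_right[OF \<phi>, of x]
      that cb by auto
  have rot: "(*) c ` cball 0 r = cball 0 r"
  proof
    show "cball 0 r \<subseteq> (*) c ` cball 0 r"
    proof
      fix x :: complex assume x: "x \<in> cball 0 r"
      have "x = c * (x / c)" using c by force
      moreover have "x / c \<in> cball 0 r" using x c by (simp add: norm_divide)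
      ultimately show "x \<in> (*) c ` cball 0 r" by blast
    qed
  qed (use c in \<open>auto simp: norm_mult\<close>)
  have "g ` L = ?\<psi> ` (*) c ` cball 0 r"
    unfolding L_def image_image by (rule image_cong[OF refl g\<psi>])
  then have "g ` L = L"
    unfolding L_def rot .
  moreover have "compact L" "L \<subseteq> \<D>"
    unfolding L_def by (rule disc_selfmap_compact_image[OF \<psi> compact_cball cb])+
  moreover have "K \<subseteq> L"
  proof
    fix z assume z: "z \<in> K"
    then have "z = ?\<psi> (\<phi> z)"
      using disc_automorphism_inv_into_left[OF \<phi>, of z] K by auto
    then show "z \<in> L"
      unfolding L_def by (rule image_eqI) (use r(2) z in blast)
  qed
  ultimately show thesis using that by blast
qed

theorem theorem2p3:
  fixes g :: "complex \<Rightarrow> complex"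
    and f :: "nat \<Rightarrow> complex \<Rightarrow> complex"
    and a b :: complex
  assumes "(\<forall>z\<in>\<D>. g z = z) \<or> disc_elliptic g"
    and "\<And>n. n \<ge> 1 \<Longrightarrow> disc_selfmap (f n) \<and> \<not> f n constant_on \<D>"
    and "a \<in> \<D>" and "b \<in> \<D>" and "a \<noteq> b"
    and "summable (\<lambda>n. hyp_dist (f (Suc n) a) (g a))"
    and "summable (\<lambda>n. hyp_dist (f (Suc n) b) (g b))"
  shows "\<exists>G. disc_selfmap G \<and> \<not> G constant_on \<D> \<and>
    (\<forall>K. compact K \<and> K \<subseteq> \<D> \<longrightarrow>
      uniform_limit K (\<lambda>n. inner_comp f n \<circ> disc_iterate_inv g n) G sequentially)"
proof -
  have f: "disc_selfmap (f (Suc n))" "\<not> f (Suc n) constant_on \<D>" for n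
    using assms(2)[of "Suc n"] by auto
  have g: "disc_automorphism g"
    using assms(1)
  proof
    assume id: "\<forall>z\<in>\<D>. g z = z"
    then have "g holomorphic_on \<D>"
      using holomorphic_cong[of \<D> \<D> g id] by auto
    moreover have "bij_betw g \<D> \<D>"
      using id bij_betw_cong[of \<D> g id \<D>] by auto
    ultimately show ?thesis
      unfolding disc_automorphism_def by blast
  qed (auto simp: disc_elliptic_def)
  let ?i = "inv_into \<D> g" and ?I = "disc_iterate_inv g"
  have gn: "disc_automorphism (g ^^ n)" "disc_automorphism (?I n)" for n
    using disc_automorphism_funpow[OF g] disc_automorphism_inv_into
    by (auto simp: disc_iterate_inv_def)
  note gi = disc_automorphism_inv_into[OF g]
  define u where "u = (\<lambda>n. ?i \<circ> f n)"
  \<comment> \<open>On the disc this is \<open>g\<^sup>n\<^sup>-\<^sup>1 \<circ> f n \<circ> g\<^sup>-\<^sup>n\<close>, but in the form of a conjugate of \<open>u n\<close>: if \<open>u n\<close> is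
    close to the identity then so is \<open>h n\<close>.\<close>
  define h where "h = (\<lambda>n. (g ^^ n) \<circ> (u n \<circ> ?I n))"
  have u: "disc_selfmap (u (Suc n))" "\<not> u (Suc n) constant_on \<D>" for n
    unfolding u_def
    by (intro disc_selfmap_comp disc_selfmap_comp_nonconstant f
        disc_automorphism_selfmap disc_automorphism_nonconstant gi)+
  have h: "disc_selfmap (h (Suc n))" "\<not> h (Suc n) constant_on \<D>" for n
    unfolding h_def
    by (intro disc_selfmap_comp disc_selfmap_comp_nonconstant u
        disc_automorphism_selfmap disc_automorphism_nonconstant gn)+
  have conj: "inner_comp h n z = (inner_comp f n \<circ> ?I n) z" if "z \<in> \<D>" for n z
    using that
  proof (induction n arbitrary: z)
    case 0
    then show ?case
      using disc_automorphism_inv_into_left[OF gn(1)[of 0]] by (simp add: disc_iterate_inv_def)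
  next
    case (Suc n)
    define y where "y = f (Suc n) (?I (Suc n) z)"
    have y: "y \<in> \<D>"
      unfolding y_def
      by (intro disc_selfmap_in[OF f(1)] disc_selfmap_in[OF disc_automorphism_selfmap[OF gn(2)]]
          Suc.prems)
    have "h (Suc n) z = (g ^^ n) (g (?i y))"
      by (simp add: h_def u_def y_def funpow_swap1)
    also have "\<dots> = (g ^^ n) y"
      using disc_automorphism_inv_into_right[OF g y] by simp
    finally have hz: "h (Suc n) z = (g ^^ n) y" .
    have "inner_comp h (Suc n) z = inner_comp f n (?I n ((g ^^ n) y))"
      using Suc.IH[OF disc_selfmap_in[OF h(1) Suc.prems, of n]]
      by (simp only: inner_comp.simps o_apply hz)
    also have "\<dots> = inner_comp f n y"
      using disc_automorphism_inv_into_left[OF gn(1) y] by (simp add: disc_iterate_inv_def)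
    finally show ?case by (simp add: y_def)
  qed
  have sum_u: "summable (\<lambda>n. norm (u (Suc n) p - p))"
    if p: "p \<in> \<D>" and s: "summable (\<lambda>n. hyp_dist (f (Suc n) p) (g p))" for p
  proof (rule summable_comparison_test'[of _ 0])
    let ?c = "2 / (1 - norm (g p)) * 2"
    show "summable (\<lambda>n. ?c * hyp_dist (f (Suc n) p) (g p))"
      by (rule summable_mult[OF s])
    fix n
    have gp: "g p \<in> \<D>" and fp: "f (Suc n) p \<in> \<D>"
      using disc_selfmap_in[OF disc_automorphism_selfmap[OF g] p] disc_selfmap_in[OF f(1) p] by auto
    have "norm (u (Suc n) p - p) = norm (?i (f (Suc n) p) - ?i (g p))"
      using disc_automorphism_inv_into_left[OF g p] by (simp add: u_def)
    also have "\<dots> \<le> 2 / (1 - norm (g p)) * norm (f (Suc n) p - g p)"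
      by (rule disc_selfmap_lipschitz[OF disc_automorphism_selfmap[OF gi] gp fp])
    also have "\<dots> \<le> 2 / (1 - norm (g p)) * (2 * hyp_dist (f (Suc n) p) (g p))"
      using gp by (intro mult_left_mono norm_diff_le_hyp_dist[OF fp gp]) auto
    finally show "norm (norm (u (Suc n) p - p)) \<le> ?c * hyp_dist (f (Suc n) p) (g p)"
      by simp
  qed
  have "\<exists>M. summable M \<and> (\<forall>n. \<forall>z\<in>K. norm (h (Suc n) z - z) \<le> M n)"
    if K: "compact K" "K \<subseteq> \<D>" for K
  proof -
    obtain L where L: "compact L" "K \<subseteq> L" "L \<subseteq> \<D>" "g ` L = L"
      using disc_elliptic_invariant_compact[OF assms(1) K] .
    obtain r where r: "r < 1" "L \<subseteq> cball 0 r"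
      using compact_in_disc_imp_smaller_cball[OF L(1,3)] by metis
    obtain C where C: "\<And>v w. disc_selfmap v \<Longrightarrow> w \<in> L \<Longrightarrow>
        norm (v w - w) \<le> C * (norm (v a - a) + norm (v b - b))"
      using disc_selfmap_near_identity[OF assms(3-5) L(1,3)] by metis
    have gL: "(g ^^ n) ` L = L" for n
    proof (induction n)
      case (Suc n)
      have "(g ^^ Suc n) ` L = g ` ((g ^^ n) ` L)" by (simp add: image_comp)
      then show ?case using Suc L(4) by simp
    qed simp
    let ?e = "\<lambda>n. norm (u (Suc n) a - a) + norm (u (Suc n) b - b)"
    show ?thesis
    proof (intro exI[of _ "\<lambda>n. 2 / (1 - r) * (C * ?e n)"] conjI allI ballI)
      show "summable (\<lambda>n. 2 / (1 - r) * (C * ?e n))"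
        by (intro summable_mult summable_add sum_u assms)
      fix n z assume z: "z \<in> K"
      obtain w where w: "w \<in> L" "(g ^^ Suc n) w = z"
        using z L(2) gL[of "Suc n"] by (metis imageE subsetD)
      \<comment> \<open>Invariance of \<open>L\<close> keeps the preimage \<open>w\<close> in a compact set independent of \<open>n\<close>; there both
        the bound on \<open>u\<close> and the Lipschitz bound for \<open>g\<^sup>n\<close> are uniform.\<close>
      have wD: "w \<in> \<D>" using w L(3) by blast
      have "?I (Suc n) z = w"
        using disc_automorphism_inv_into_left[OF gn(1) wD] w(2) by (metis disc_iterate_inv_def)
      then have "norm (h (Suc n) z - z) = norm ((g ^^ Suc n) (u (Suc n) w) - (g ^^ Suc n) w)"
        using w(2) by (simp only: h_def o_apply)
      also have "\<dots> \<le> 2 / (1 - norm w) * norm (u (Suc n) w - w)"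
        using disc_selfmap_lipschitz[OF disc_automorphism_selfmap[OF gn(1)] wD
            disc_selfmap_in[OF u(1) wD]] .
      also have "\<dots> \<le> 2 / (1 - r) * (C * ?e n)"
        using r w(1) C[OF u(1) w(1)] by (intro mult_mono divide_left_mono mult_pos_pos) auto
      finally show "norm (h (Suc n) z - z) \<le> 2 / (1 - r) * (C * ?e n)" .
    qed
  qed
  then obtain G where G: "disc_selfmap G" "\<not> G constant_on \<D>"
    "\<And>K. compact K \<Longrightarrow> K \<subseteq> \<D> \<Longrightarrow> uniform_limit K (inner_comp h) G sequentially"
    using inner_comp_converges_nonconstant[of h, OF h] by metis
  have "uniform_limit K (\<lambda>n. inner_comp f n \<circ> ?I n) G sequentially"
    if K: "compact K" "K \<subseteq> \<D>" for K
  proof (rule uniform_limit_cong'[THEN iffD1, OF _ _ G(3)[OF K]])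
    show "inner_comp h n z = (inner_comp f n \<circ> ?I n) z" if "z \<in> K" for n z
      using conj K that by blast
  qed simp
  then show ?thesis using G(1,2) by blast
qed

end
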